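(* Let $H$ be a real Hilbert space and let $J:H\to\mathbb{R}$ be twice continuously Fréchet differentiable with a global minimizer $x^*\in H$. Suppose that for some constant $L>0$ $$\|J''(x)-J''(y)\|_{L(H)}\le L\|x-y\|,\quad x,y\in H.$$ Let $\xi\in H$ and suppose that $w\in H$ satisfies the source condition $x^*-\xi=J''(x^* )w$ and $L\|w\|<1$. Let $K\ge 0$ be fixed. Then there is a constant $C_0\ge 0$, independent of $\alpha$ and $\varepsilon$, such that for all $\alpha>0$, all $\varepsilon$ with $0\le\varepsilon\le K\alpha^3$, and every point $u_{\alpha,\varepsilon}\in H$ satisfying $$\inf_{x\in H}T_\alpha(x)\le T_\alpha(u_{\alpha,\varepsilon})\le\inf_{x\in H}T_\alpha(x)+\varepsilon,$$ where $T_\alpha(x)=J(x)+\alpha\|x-\xi\|^2$, one has $$\|u_{\alpha,\varepsilon}-x^*\|\le C_0\alpha.$$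
   Context: $\|\cdot\|$ is the norm of $H$ and $\|\cdot\|_{L(H)}$ is the operator norm on bounded linear operators on $H$. $J'(x)\in H$ is the gradient and $J''(x)\in L(H)$ the (self-adjoint) second Fréchet derivative, via the Riesz identification. $T_\alpha$ is the Tikhonov functional with regularization parameter $\alpha>0$. The constant $C_0$ may depend on $J$, $x^*$, $\xi$, $w$, $L$ and $K$. For $\varepsilon=0$ the statement concerns exact global minimizers of $T_\alpha$, if they exist. *)

theory Defs
  imports "HOL-Analysis.Analysis"
begin

definition tikhonov :: "('a::real_inner \<Rightarrow> real) \<Rightarrow> 'a \<Rightarrow> real \<Rightarrow> 'a \<Rightarrow> real"
  where "tikhonov J \<xi> \<alpha> x = J x + \<alpha> * (norm (x - \<xi>))\<^sup>2"

text \<open>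
  \<open>J'\<close> is the gradient of \<open>J\<close> (the Riesz representative of its Frechet derivative) and
  \<open>J''\<close> the second Frechet derivative, identified with a bounded operator on the space, i.e.
  the derivative of the gradient map.  Both are uniquely determined by \<open>J\<close>.  Continuity of
  \<open>J''\<close> is with respect to the operator norm, which is the norm of \<open>blinfun\<close>.
\<close>
definition twice_cont_frechet_diff ::
    "('a::real_inner \<Rightarrow> real) \<Rightarrow> ('a \<Rightarrow> 'a) \<Rightarrow> ('a \<Rightarrow> 'a \<Rightarrow>\<^sub>L 'a) \<Rightarrow> bool"
  where "twice_cont_frechet_diff J J' J'' \<longleftrightarrow>
    (\<forall>x. GDERIV J x :> J' x) \<and>
    (\<forall>x. (J' has_derivative blinfun_apply (J'' x)) (at x)) \<and>
    continuous_on UNIV J''"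

end

theory Submission
  imports Defs
begin

text \<open>
  With \<open>h = 2 * \<alpha> * w\<close>, test near-minimality of \<open>u\<close> against \<open>xstar - h\<close>,
  and test minimality of \<open>xstar\<close> against \<open>u + h\<close>.  The mixed second difference of \<open>J\<close> turns
  \<open>J (u + h) - J u\<close> into \<open>J (xstar + h) - J xstar\<close> plus the term \<open>2 * \<alpha> * ((J'' xstar w) \<bullet> (u - xstar))\<close>
  produced by the penalty.  Adding up, this term and all contributions of order \<open>\<alpha>\<^sup>2\<close> cancel, leaving
  \<open>(1 - L * norm w) * \<alpha> * (norm (u - xstar))\<^sup>2\<close> bounded by terms of order \<open>\<alpha>\<^sup>3\<close> and
  \<open>\<alpha>\<^sup>2 * norm (u - xstar)\<close>.
\<close>

text \<open>Pairing with \<open>v\<close> makes the gradient along the segment from \<open>p\<close>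
  to \<open>p + h\<close> a real function, so the mean value theorem gives an exact intermediate
  point. That point lies within \<open>norm (p - q) + norm h\<close> of \<open>q\<close>, and the
  Lipschitz bound applies there.\<close>

lemma gradient_difference_bound:
  fixes J' :: "'a::real_inner \<Rightarrow> 'a" and J'' :: "'a \<Rightarrow> 'a \<Rightarrow>\<^sub>L 'a"
  assumes deriv: "\<And>x. (J' has_derivative blinfun_apply (J'' x)) (at x)"
    and lipschitz: "\<And>x y. norm (J'' x - J'' y) \<le> L * norm (x - y)"
    and "L \<ge> 0"
  shows "\<bar>(J' (p + h) - J' p) \<bullet> v - J'' q h \<bullet> v\<bar> \<le> L * (norm (p - q) + norm h) * norm h * norm v"
proof -
  let ?f = "\<lambda>t::real. J' (p + t *\<^sub>R h) \<bullet> v"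
  have D: "(?f has_derivative (\<lambda>s. (J'' (p + t *\<^sub>R h) (s *\<^sub>R h)) \<bullet> v)) (at t within {0..1})" for t
    by (rule has_derivative_at_withinI)
      (auto intro!: derivative_eq_intros has_derivative_compose[OF _ deriv])
  from mvt_simple[of 0 1 ?f, OF _ D]
  obtain t where t: "t \<in> {0<..<1}" and "?f 1 - ?f 0 = J'' (p + t *\<^sub>R h) h \<bullet> v"
    by auto
  then have "(J' (p + h) - J' p) \<bullet> v - J'' q h \<bullet> v = (J'' (p + t *\<^sub>R h) - J'' q) h \<bullet> v"
    by (simp add: inner_diff_left blinfun.diff_left)
  also have "\<bar>\<dots>\<bar> \<le> norm ((J'' (p + t *\<^sub>R h) - J'' q) h) * norm v"
    by (rule Cauchy_Schwarz_ineq2)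
  also have "\<dots> \<le> norm (J'' (p + t *\<^sub>R h) - J'' q) * norm h * norm v"
    by (intro mult_right_mono norm_blinfun) auto
  also have "\<dots> \<le> L * (norm (p - q) + norm h) * norm h * norm v"
  proof (intro mult_right_mono norm_ge_zero)
    have "norm (p + t *\<^sub>R h - q) \<le> norm (p - q) + norm (t *\<^sub>R h)"
      using norm_triangle_ineq[of "p - q" "t *\<^sub>R h"] by (simp add: algebra_simps)
    also have "\<dots> \<le> norm (p - q) + norm h"
      using t by (auto intro: mult_left_le_one_le)
    finally show "norm (J'' (p + t *\<^sub>R h) - J'' q) \<le> L * (norm (p - q) + norm h)"
      using lipschitz order_trans mult_left_mono[OF _ \<open>L \<ge> 0\<close>] by blast
  qed
  finally show ?thesis .
qed

text \<open>Integrating the preceding bound along \<open>v\<close> produces the factor 1/2 on the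
  term quadratic in \<open>v\<close>. For \<open>h = (2 * \<alpha>) *\<^sub>R w\<close> this term is
  \<open>\<alpha> * L * norm w * (norm v)\<^sup>2\<close>, which explains the threshold
  \<open>L * norm w < 1\<close>.\<close>

lemma mixed_difference_bound:
  fixes J :: "'a::real_inner \<Rightarrow> real" and J' :: "'a \<Rightarrow> 'a" and J'' :: "'a \<Rightarrow> 'a \<Rightarrow>\<^sub>L 'a"
  assumes grad: "\<And>x. GDERIV J x :> J' x"
    and deriv: "\<And>x. (J' has_derivative blinfun_apply (J'' x)) (at x)"
    and lipschitz: "\<And>x y. norm (J'' x - J'' y) \<le> L * norm (x - y)"
    and "L \<ge> 0"
  shows "\<bar>J (q + v + h) - J (q + v) - J (q + h) + J q - J'' q h \<bullet> v\<bar>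
    \<le> L * norm h * (norm v)\<^sup>2 / 2 + L * (norm h)\<^sup>2 * norm v"
proof -
  define g where "g t = J (q + h + t *\<^sub>R v) - J (q + t *\<^sub>R v) - t * (J'' q h \<bullet> v)" for t
  define g' where "g' t = (J' (q + h + t *\<^sub>R v) - J' (q + t *\<^sub>R v)) \<bullet> v - J'' q h \<bullet> v" for t
  \<comment> \<open>\<open>\<phi>\<close> is a majorant for \<open>g\<close>: its derivative is the
    bound on the derivative of \<open>g\<close>, \<open>\<phi> 0 = 0\<close>, and
    \<open>\<phi> 1\<close> is the claimed right-hand side.\<close>
  define \<phi> where "\<phi> t = L * norm h * (norm v)\<^sup>2 * t\<^sup>2 / 2 + L * (norm h)\<^sup>2 * norm v * t" for t :: real
  define \<phi>' where "\<phi>' t = L * norm h * (norm v)\<^sup>2 * t + L * (norm h)\<^sup>2 * norm v" for t :: real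
  have J: "((\<lambda>t. J (p + t *\<^sub>R v)) has_real_derivative J' (p + t *\<^sub>R v) \<bullet> v) (at t)" for p t
  proof -
    have *: "((\<lambda>t. p + t *\<^sub>R v) has_derivative (\<lambda>s. s *\<^sub>R v)) (at t)"
      by (auto intro!: derivative_eq_intros)
    show ?thesis
      using has_derivative_compose[OF * grad[unfolded gderiv_def]]
      by (simp add: has_field_derivative_def inner_commute mult.commute[of _ "_ \<bullet> _"])
  qed
  have g: "(g has_vector_derivative g' t) (at t)" for t
    unfolding g_def g'_def has_real_derivative_iff_has_vector_derivative[symmetric]
    by (auto intro!: derivative_eq_intros J simp: inner_diff_left)
  have \<phi>: "(\<phi> has_vector_derivative \<phi>' t) (at t)" for t
    unfolding \<phi>_def \<phi>'_def has_real_derivative_iff_has_vector_derivative[symmetric]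
    by (auto intro!: derivative_eq_intros)
  have "norm (g' t) \<le> \<phi>' t" if "0 < t" for t
  proof -
    have "norm (g' t) \<le> L * (norm (q + t *\<^sub>R v - q) + norm h) * norm h * norm v"
      using gradient_difference_bound[OF deriv lipschitz \<open>L \<ge> 0\<close>, of "q + t *\<^sub>R v" h v q]
      by (simp add: g'_def add_ac)
    also have "\<dots> = \<phi>' t"
      using that by (simp add: \<phi>'_def algebra_simps power2_eq_square)
    finally show ?thesis .
  qed
  moreover have "continuous_on {0..1} g" "continuous_on {0..1} \<phi>"
    using g \<phi> by (auto intro!: continuous_at_imp_continuous_on has_vector_derivative_continuous)
  ultimately have "norm (g 1 - g 0) \<le> \<phi> 1 - \<phi> 0"
    using differentiable_bound_general[of 0 1 g \<phi> g' \<phi>'] g \<phi> by simp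
  then show ?thesis
    by (simp add: g_def \<phi>_def algebra_simps)
qed

text \<open>If \<open>a > \<alpha>\<close>, one factor \<open>\<alpha>\<close> in
  \<open>M * \<alpha>\<^sup>2\<close> can be replaced by \<open>a\<close>, and dividing by
  \<open>a\<close> leaves a linear inequality. The summand 1 covers the case
  \<open>a \<le> \<alpha>\<close>.\<close>

lemma quadratic_inequality_linear_bound:
  fixes a \<alpha> \<delta> M N :: real
  assumes "\<delta> > 0" "\<alpha> > 0" "M \<ge> 0" "N \<ge> 0" "a \<ge> 0"
    and ineq: "\<delta> * a\<^sup>2 \<le> M * \<alpha>\<^sup>2 + N * \<alpha> * a"
  shows "a \<le> ((M + N) / \<delta> + 1) * \<alpha>"
proof (cases "a \<le> \<alpha>")
  case True
  moreover have "(M + N) / \<delta> * \<alpha> \<ge> 0"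
    using assms by simp
  ultimately show ?thesis
    by (simp add: algebra_simps)
next
  case False
  then have "M * \<alpha> * \<alpha> \<le> M * \<alpha> * a"
    using assms by (intro mult_left_mono) auto
  then have "\<delta> * a * a \<le> (M + N) * \<alpha> * a"
    using ineq by (simp add: power2_eq_square algebra_simps)
  then have "\<delta> * a \<le> (M + N) * \<alpha>"
    using False \<open>\<alpha> > 0\<close> by simp
  then have "a \<le> (M + N) / \<delta> * \<alpha>"
    using \<open>\<delta> > 0\<close> by (simp add: field_simps)
  then show ?thesis
    using \<open>\<alpha> > 0\<close> by (simp add: algebra_simps)
qed

theorem theorem2p1:
  fixes J :: "'a::{real_inner, complete_space} \<Rightarrow> real"
    and J' :: "'a \<Rightarrow> 'a"
    and J'' :: "'a \<Rightarrow> 'a \<Rightarrow>\<^sub>L 'a"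
    and xstar \<xi> w :: 'a
    and L K :: real
  assumes diff: "twice_cont_frechet_diff J J' J''"
    and minimizer: "\<forall>x. J xstar \<le> J x"
    and L_pos: "L > 0"
    and lipschitz: "\<forall>x y. norm (J'' x - J'' y) \<le> L * norm (x - y)"
    and source: "xstar - \<xi> = J'' xstar w"
    and small: "L * norm w < 1"
    and K_nonneg: "K \<ge> 0"
  shows "\<exists>C0\<ge>0. \<forall>\<alpha>>0. \<forall>\<epsilon>. 0 \<le> \<epsilon> \<and> \<epsilon> \<le> K * \<alpha> ^ 3 \<longrightarrow>
    (\<forall>u. (INF x. tikhonov J \<xi> \<alpha> x) \<le> tikhonov J \<xi> \<alpha> u \<and>
         tikhonov J \<xi> \<alpha> u \<le> (INF x. tikhonov J \<xi> \<alpha> x) + \<epsilon> \<longrightarrow>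
         norm (u - xstar) \<le> C0 * \<alpha>)"
proof -
  have grad: "\<And>x. GDERIV J x :> J' x"
    and deriv: "\<And>x. (J' has_derivative blinfun_apply (J'' x)) (at x)"
    using diff by (auto simp: twice_cont_frechet_diff_def)
  note mixed = mixed_difference_bound[OF grad deriv lipschitz[rule_format], OF less_imp_le[OF L_pos]]
  define b where "b = norm w"
  \<comment> \<open>After division by \<open>\<alpha>\<close>, with
    \<open>norm h = 2 * \<alpha> * b\<close>, the summands of \<open>M\<close> come from
    \<open>\<alpha> * (norm h)\<^sup>2\<close>, from \<open>3 * (L * (norm h) ^ 3) / 2\<close> and
    from \<epsilon>; \<open>N\<close> comes from \<open>L * (norm h)\<^sup>2 * a\<close>.\<close>
  define M where "M = 4 * b\<^sup>2 + 12 * L * b ^ 3 + K"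
  define N where "N = 4 * L * b\<^sup>2"
  have b: "b \<ge> 0" "1 - L * b > 0"
    using small by (auto simp: b_def)
  have MN: "M \<ge> 0" "N \<ge> 0"
    using b L_pos K_nonneg by (auto simp: M_def N_def)
  have bound: "norm (u - xstar) \<le> ((M + N) / (1 - L * b) + 1) * \<alpha>"
    if \<alpha>: "\<alpha> > 0" and \<epsilon>: "\<epsilon> \<le> K * \<alpha> ^ 3"
      and u: "tikhonov J \<xi> \<alpha> u \<le> (INF x. tikhonov J \<xi> \<alpha> x) + \<epsilon>" for \<alpha> \<epsilon> u
  proof (rule quadratic_inequality_linear_bound)
    define h where "h = (2 * \<alpha>) *\<^sub>R w"
    define e where "e = u - xstar"
    define a where "a = norm e"
    define z where "z = J'' xstar w"
    have h_norm: "norm h = 2 * \<alpha> * b"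
      using \<alpha> by (simp add: h_def b_def)
    have Jh: "J'' xstar h = (2 * \<alpha>) *\<^sub>R z"
      by (simp add: h_def z_def blinfun.scaleR_right)
    \<comment> \<open>Boundedness below ensures that the real infimum is a lower bound for the
      values of the functional.\<close>
    have "bdd_below (range (tikhonov J \<xi> \<alpha>))"
      using minimizer \<alpha> by (intro bdd_belowI[of _ "J xstar"]) (auto simp: tikhonov_def intro: add_increasing2)
    then have "tikhonov J \<xi> \<alpha> u \<le> tikhonov J \<xi> \<alpha> (xstar - h) + \<epsilon>"
      using cINF_lower[of "tikhonov J \<xi> \<alpha>" UNIV "xstar - h"] u by simp
    \<comment> \<open>By the source condition \<open>z = xstar - \<xi>\<close>, so both penalties
      expand around \<open>z\<close> and \<open>(norm z)\<^sup>2\<close> cancels between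
      them.\<close>
    moreover have "(norm (u - \<xi>))\<^sup>2 = a\<^sup>2 + 2 * (z \<bullet> e) + (norm z)\<^sup>2"
    proof -
      have "u - \<xi> = e + z"
        using source by (simp add: e_def z_def algebra_simps)
      then show ?thesis
        by (simp add: a_def power2_norm_eq_inner inner_add_left inner_add_right inner_commute)
    qed
    moreover have "(norm (xstar - h - \<xi>))\<^sup>2 = (norm h)\<^sup>2 - 2 * (z \<bullet> h) + (norm z)\<^sup>2"
    proof -
      have "xstar - h - \<xi> = z - h"
        using source by (simp add: z_def algebra_simps)
      then show ?thesis
        by (simp only: power2_norm_eq_inner) (simp add: inner_diff_left inner_diff_right inner_commute)
    qed
    ultimately have near_min: "J u + \<alpha> * a\<^sup>2 + 2 * \<alpha> * (z \<bullet> e)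
        \<le> J (xstar - h) + \<alpha> * (norm h)\<^sup>2 - 2 * \<alpha> * (z \<bullet> h) + \<epsilon>"
      by (simp only: tikhonov_def) (simp add: distrib_left right_diff_distrib)
    have "J xstar \<le> J (u + h)"
      using minimizer by simp
    also have "\<dots> \<le> J u + J (xstar + h) - J xstar + 2 * \<alpha> * (z \<bullet> e)
        + L * norm h * a\<^sup>2 / 2 + L * (norm h)\<^sup>2 * a"
      using mixed[of xstar e h] by (simp add: Jh e_def a_def)
    finally have min: "J xstar \<le> \<dots>" .
    \<comment> \<open>The choice \<open>v = - h\<close> collapses the mixed difference to the
      symmetric second difference at \<open>xstar\<close>.\<close>
    have second_diff: "J (xstar + h) + J (xstar - h) - 2 * J xstar
        \<le> 2 * \<alpha> * (z \<bullet> h) + 3 * (L * (norm h) ^ 3) / 2"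
      using abs_le_D2[OF mixed[of xstar "- h" h]]
      by (simp add: Jh power2_eq_square power3_eq_cube mult.assoc)
    \<comment> \<open>In the sum of the three inequalities all values of \<open>J\<close> and the
      terms in \<open>z \<bullet> e\<close> and \<open>z \<bullet> h\<close> cancel.\<close>
    have "\<alpha> * a\<^sup>2 \<le> \<alpha> * (norm h)\<^sup>2 + L * norm h * a\<^sup>2 / 2 + L * (norm h)\<^sup>2 * a
        + 3 * (L * (norm h) ^ 3) / 2 + K * \<alpha> ^ 3"
      using near_min min second_diff \<epsilon> by linarith
    \<comment> \<open>Here \<open>L * norm h * a\<^sup>2 / 2\<close> equals
      \<open>\<alpha> * L * b * a\<^sup>2\<close> and is absorbed on the left.\<close>
    then have "\<alpha> * ((1 - L * b) * a\<^sup>2) \<le> \<alpha> * (M * \<alpha>\<^sup>2 + N * \<alpha> * a)"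
      by (simp add: h_norm M_def N_def power2_eq_square power3_eq_cube algebra_simps)
    then show "(1 - L * b) * (norm (u - xstar))\<^sup>2 \<le> M * \<alpha>\<^sup>2 + N * \<alpha> * norm (u - xstar)"
      using \<alpha> by (simp add: a_def e_def)
  qed (use b MN \<alpha> in auto)
  show ?thesis
    using bound b MN by (intro exI[of _ "(M + N) / (1 - L * b) + 1"]) auto
qed

end
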